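(* Let $\gamma>0$. Fix a stage $t$, a node $j$ and a trial point $\hat s\in[0,S_{\max}]$. Suppose that for each successor node $j'$ we have an affine minorant $$v_{j'}+\beta_{j'}(s-\hat s)\le V_{t+1,j'}(s)\qquad\text{for all } s\in[0,S_{\max}],$$ with $v_{j'},\beta_{j'}\in\mathbb R$, where $v_{j'}=\underline V_{t+1,j'}(\hat s)$ is the value at $\hat s$ of a lower approximation of $V_{t+1,j'}$ (for example, obtained by solving the stage subproblem at $(t+1,j',\hat s)$ with the current cuts, with $\beta_{j'}$ its storage dual). Let $$\tilde w_{j'}=\frac{P_t[j,j']e^{\gamma v_{j'}}}{\sum_k P_t[j,k]e^{\gamma v_k}},\qquad \bar b=\sum_{j'}\tilde w_{j'}\beta_{j'},\qquad \bar a=\rho^{t,j}_\gamma(v)-\bar b\,\hat s .$$ Then $$\bar a+\bar b\,s\le W_{t,j}(s)\qquad\text{for all } s\in[0,S_{\max}],$$ with equality at $s=\hat s$ whenever the minorants are tight there (i.e. $v_{j'}=V_{t+1,j'}(\hat s)$ for all $j'$). The statement also covers the risk-neutral case $\gamma\to0$ with $\tilde w\to P_t[j,\cdot]$, i.e. it holds with $\tilde w=P_t[j,\cdot]$ and $\rho_0^{t,j}(v)=\sum_{j'}P_t[j,j']v_{j'}$ in place of $\rho_\gamma^{t,j}$.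
   Context: Stages $t$ are weeks (periodic indexing modulo $52$), and $j,j'$ range over a finite set of inflow nodes with row-stochastic transition matrices $P_t[j,j']$. The functions $V_{t,j}:[0,S_{\max}]\to\mathbb R$ are the (convex, nonincreasing) cost-to-go functions of the periodic storage problem, satisfying $V_{t,j}(s)=\min_u\{c_{t,j}(s,u)+\delta W_{t,j}(s')\}$, with nonnegative stage cost $c_{t,j}$, per-stage discount $\delta\in(0,1)$, and next storage $s'\in[0,S_{\max}]$. For a vector $v=(v_{j'})_{j'}$, the entropic risk measure is $$\rho_\gamma^{t,j}(v)=\frac1\gamma\log\sum_{j'}P_t[j,j']e^{\gamma v_{j'}},\qquad \gamma>0,$$ and the risk-adjusted future cost is $W_{t,j}(s)=\rho_\gamma^{t,j}\big(V_{t+1,\cdot}(s)\big)$. *)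

theory Defs
  imports "HOL-Analysis.Analysis"
begin

text \<open>Weeks with addition modulo 52: the successor stage of \<open>t\<close> is \<open>t + 1\<close>, and week 51 is
  followed by week 0.\<close>

type_synonym week = 52

text \<open>In the next two definitions \<open>p\<close> is a row \<open>P t j\<close> of a transition matrix. The value
  \<open>\<gamma> = 0\<close> denotes the risk-neutral case.\<close>

definition risk :: "real \<Rightarrow> ('j::finite \<Rightarrow> real) \<Rightarrow> ('j \<Rightarrow> real) \<Rightarrow> real" where
  "risk \<gamma> p v =
    (if \<gamma> = 0 then (\<Sum>j'\<in>UNIV. p j' * v j')
     else (1 / \<gamma>) * ln (\<Sum>j'\<in>UNIV. p j' * exp (\<gamma> * v j')))"

definition tilted_weight :: "real \<Rightarrow> ('j::finite \<Rightarrow> real) \<Rightarrow> ('j \<Rightarrow> real) \<Rightarrow> 'j \<Rightarrow> real" where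
  "tilted_weight \<gamma> p v j' =
    (if \<gamma> = 0 then p j'
     else p j' * exp (\<gamma> * v j') / (\<Sum>k\<in>UNIV. p k * exp (\<gamma> * v k)))"

definition future_cost ::
    "real \<Rightarrow> (week \<Rightarrow> 'j::finite \<Rightarrow> 'j \<Rightarrow> real) \<Rightarrow> (week \<Rightarrow> 'j \<Rightarrow> real \<Rightarrow> real)
      \<Rightarrow> week \<Rightarrow> 'j \<Rightarrow> real \<Rightarrow> real" where
  "future_cost \<gamma> P V t j s = risk \<gamma> (P t j) (\<lambda>j'. V (t + 1) j' s)"

text \<open>The set \<open>U t j s\<close> consists of the feasible controls and \<open>nxt t j s u\<close> is the next storage.
  The functions \<open>V t j\<close> are total in HOL, but only their values on \<open>{0..Smax}\<close> are constrained.
  The assumptions \<open>V_attained\<close> and \<open>V_le\<close> together are the Bellman equation, with an attained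
  minimum over \<open>u\<close>.\<close>

locale storage_problem =
  fixes Smax \<delta> \<gamma> :: real
    and P :: "week \<Rightarrow> 'j::finite \<Rightarrow> 'j \<Rightarrow> real"
    and U :: "week \<Rightarrow> 'j \<Rightarrow> real \<Rightarrow> 'u set"
    and c :: "week \<Rightarrow> 'j \<Rightarrow> real \<Rightarrow> 'u \<Rightarrow> real"
    and nxt :: "week \<Rightarrow> 'j \<Rightarrow> real \<Rightarrow> 'u \<Rightarrow> real"
    and V :: "week \<Rightarrow> 'j \<Rightarrow> real \<Rightarrow> real"
  assumes Smax_nonneg: "0 \<le> Smax"
    and discount: "0 < \<delta>" "\<delta> < 1"
    and P_nonneg: "\<And>t j j'. 0 \<le> P t j j'"
    and P_row_sum: "\<And>t j. (\<Sum>j'\<in>UNIV. P t j j') = 1"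
    and c_nonneg: "\<And>t j s u. s \<in> {0..Smax} \<Longrightarrow> u \<in> U t j s \<Longrightarrow> 0 \<le> c t j s u"
    and nxt_range: "\<And>t j s u. s \<in> {0..Smax} \<Longrightarrow> u \<in> U t j s \<Longrightarrow> nxt t j s u \<in> {0..Smax}"
    and V_convex: "\<And>t j. convex_on {0..Smax} (V t j)"
    and V_nonincreasing: "\<And>t j. antimono_on {0..Smax} (V t j)"
    and V_attained: "\<And>t j s. s \<in> {0..Smax} \<Longrightarrow>
      \<exists>u\<in>U t j s. V t j s = c t j s u + \<delta> * future_cost \<gamma> P V t j (nxt t j s u)"
    and V_le: "\<And>t j s u. s \<in> {0..Smax} \<Longrightarrow> u \<in> U t j s \<Longrightarrow>
      V t j s \<le> c t j s u + \<delta> * future_cost \<gamma> P V t j (nxt t j s u)"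

end

theory Submission imports Defs begin

text \<open>The risk measure is nondecreasing, so it suffices to evaluate it on the minorants. It is also
  convex, and the tilted weights are its gradient at \<open>v\<close>; the cut is the resulting tangent.
  Convexity is Jensen's inequality for \<open>exp\<close> under the tilted weights.\<close>

text \<open>Entries of \<open>p\<close> may vanish, so a positive one is extracted from the row sum.
  This keeps the argument of \<open>ln\<close> and the denominator of the tilted weights
  positive.\<close>

lemma sum_exp_pos:
  fixes p v :: "'j::finite \<Rightarrow> real"
  assumes "\<And>k. 0 \<le> p k" and "sum p UNIV = 1"
  shows "0 < (\<Sum>k\<in>UNIV. p k * exp (\<gamma> * v k))"
proof -
  obtain i where "p i \<noteq> 0"
    using assms(2) by (metis sum.neutral zero_neq_one)
  then have "0 < p i"
    using assms(1)[of i] by simp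
  then show ?thesis
    using assms(1) by (intro sum_pos2[of UNIV i]) auto
qed

lemma tilted_weight_nonneg:
  assumes "\<And>k. 0 \<le> p k"
  shows "0 \<le> tilted_weight \<gamma> p v k"
  using assms by (auto simp: tilted_weight_def intro!: divide_nonneg_nonneg sum_nonneg)

lemma sum_tilted_weight:
  assumes "\<And>k. 0 \<le> p k" and "sum p UNIV = 1"
  shows "sum (tilted_weight \<gamma> p v) UNIV = 1"
  using sum_exp_pos[OF assms, of \<gamma> v] assms(2)
  by (cases "\<gamma> = 0") (simp_all add: tilted_weight_def flip: sum_divide_distrib)

lemma risk_mono:
  assumes "0 \<le> \<gamma>" and "\<And>k. 0 \<le> p k" and "sum p UNIV = 1" and "\<And>k. v k \<le> v' k"
  shows "risk \<gamma> p v \<le> risk \<gamma> p v'"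
proof (cases "\<gamma> = 0")
  case True
  then show ?thesis
    using assms by (auto simp: risk_def intro!: sum_mono mult_left_mono)
next
  case False
  have "(\<Sum>k\<in>UNIV. p k * exp (\<gamma> * v k)) \<le> (\<Sum>k\<in>UNIV. p k * exp (\<gamma> * v' k))"
    using assms by (auto intro!: sum_mono mult_left_mono)
  then have "ln (\<Sum>k\<in>UNIV. p k * exp (\<gamma> * v k)) \<le> ln (\<Sum>k\<in>UNIV. p k * exp (\<gamma> * v' k))"
    using sum_exp_pos[OF assms(2,3)] by (intro ln_mono) auto
  then show ?thesis
    using False assms(1) by (auto simp: risk_def intro!: divide_right_mono)
qed

text \<open>At \<open>\<gamma> = 0\<close> the measure is linear in \<open>v\<close> and equality
  holds. Otherwise taking \<open>ln\<close> in Jensen's inequality turns a ratio of exponential sums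
  into \<open>\<gamma>\<close> times the difference of the two risks.\<close>

lemma risk_ge_tangent:
  assumes "0 \<le> \<gamma>" and "\<And>k. 0 \<le> p k" and "sum p UNIV = 1"
  shows "risk \<gamma> p v + (\<Sum>k\<in>UNIV. tilted_weight \<gamma> p v k * d k) \<le> risk \<gamma> p (\<lambda>k. v k + d k)"
proof (cases "\<gamma> = 0")
  case True
  then show ?thesis
    by (simp add: risk_def tilted_weight_def sum.distrib algebra_simps)
next
  case False
  define Z where "Z u = (\<Sum>k\<in>UNIV. p k * exp (\<gamma> * u k))" for u
  define w where "w = tilted_weight \<gamma> p v"
  have Z_pos: "0 < Z u" for u
    unfolding Z_def by (rule sum_exp_pos[OF assms(2,3)])
  have "exp (\<Sum>k\<in>UNIV. w k *\<^sub>R (\<gamma> * d k)) \<le> (\<Sum>k\<in>UNIV. w k * exp (\<gamma> * d k))"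
    unfolding w_def
    by (intro convex_on_sum[OF _ _ exp_convex])
      (auto simp: sum_tilted_weight tilted_weight_nonneg assms(2,3))
  \<comment> \<open>Change of measure: the factor \<open>exp (\<gamma> * v k)\<close> in the tilted
    weight merges with \<open>exp (\<gamma> * d k)\<close>, and the normalizer \<open>Z v\<close>
    stays in the denominator.\<close>
  also have "(\<Sum>k\<in>UNIV. w k * exp (\<gamma> * d k)) = Z (\<lambda>k. v k + d k) / Z v"
    using False by (simp add: w_def tilted_weight_def Z_def sum_divide_distrib distrib_left exp_add
        mult.assoc)
  finally have "(\<Sum>k\<in>UNIV. w k * (\<gamma> * d k)) \<le> ln (Z (\<lambda>k. v k + d k) / Z v)"
    using Z_pos by (simp add: ln_ge_iff)
  also have "\<dots> = ln (Z (\<lambda>k. v k + d k)) - ln (Z v)"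
    by (rule ln_divide_pos[OF Z_pos Z_pos])
  finally have "\<gamma> * (\<Sum>k\<in>UNIV. w k * d k) \<le> ln (Z (\<lambda>k. v k + d k)) - ln (Z v)"
    by (simp add: sum_distrib_left mult.left_commute)
  then have "(\<Sum>k\<in>UNIV. w k * d k) \<le> (ln (Z (\<lambda>k. v k + d k)) - ln (Z v)) / \<gamma>"
    using False assms(1) by (simp add: pos_le_divide_eq mult.commute)
  then show ?thesis
    using False by (simp add: risk_def w_def Z_def diff_divide_distrib)
qed

text \<open>Together with the limit of \<open>risk\<close>, this justifies the values assigned by
  definition at \<open>\<gamma> = 0\<close>. The filter \<open>at_right 0\<close> omits the point 0,
  so only the exponential formula matters.\<close>

lemma tilted_weight_tendsto:
  assumes "sum p UNIV = 1"
  shows "((\<lambda>g. tilted_weight g p v k) \<longlongrightarrow> p k) (at_right 0)"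
proof (rule Lim_transform_eventually)
  have "((\<lambda>g. p k * exp (g * v k) / (\<Sum>i\<in>UNIV. p i * exp (g * v i))) \<longlongrightarrow>
      p k * exp (0 * v k) / (\<Sum>i\<in>UNIV. p i * exp (0 * v i))) (at_right 0)"
    by (intro tendsto_intros) (simp add: assms)
  then show "((\<lambda>g. p k * exp (g * v k) / (\<Sum>i\<in>UNIV. p i * exp (g * v i))) \<longlongrightarrow> p k) (at_right 0)"
    by (simp add: assms)
  show "\<forall>\<^sub>F g in at_right 0. p k * exp (g * v k) / (\<Sum>i\<in>UNIV. p i * exp (g * v i))
      = tilted_weight g p v k"
    by (auto simp: tilted_weight_def eventually_at_filter)
qed

text \<open>For \<open>g \<noteq> 0\<close>, \<open>risk g p v\<close> is the difference quotient at 0 of the cumulant generating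
  function, whose derivative there is the mean.\<close>
lemma risk_tendsto:
  assumes "sum p UNIV = 1"
  shows "((\<lambda>g. risk g p v) \<longlongrightarrow> (\<Sum>k\<in>UNIV. p k * v k)) (at_right 0)"
proof (rule Lim_transform_eventually)
  \<comment> \<open>At 0 the inner sum equals \<open>sum p UNIV = 1\<close>, so the logarithm
    contributes the factor 1 in the chain rule.\<close>
  have "((\<lambda>g. ln (\<Sum>k\<in>UNIV. p k * exp (g * v k))) has_real_derivative (\<Sum>k\<in>UNIV. p k * v k)) (at 0)"
    by (rule derivative_eq_intros refl | simp add: assms mult.commute)+
  \<comment> \<open>The difference quotient has no subtracted term because the logarithm vanishes at
    0.\<close>
  then have "((\<lambda>g. ln (\<Sum>k\<in>UNIV. p k * exp (g * v k)) / g) \<longlongrightarrow> (\<Sum>k\<in>UNIV. p k * v k)) (at 0)"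
    by (simp add: DERIV_def assms)
  then show "((\<lambda>g. ln (\<Sum>k\<in>UNIV. p k * exp (g * v k)) / g) \<longlongrightarrow> (\<Sum>k\<in>UNIV. p k * v k)) (at_right 0)"
    by (rule tendsto_mono[OF at_le, rotated]) simp
  show "\<forall>\<^sub>F g in at_right 0. ln (\<Sum>k\<in>UNIV. p k * exp (g * v k)) / g = risk g p v"
    by (auto simp: risk_def eventually_at_filter)
qed

theorem lemma2p3:
  fixes Smax \<delta> \<gamma> s_hat :: real
    and P :: "week \<Rightarrow> 'j::finite \<Rightarrow> 'j \<Rightarrow> real"
    and U :: "week \<Rightarrow> 'j \<Rightarrow> real \<Rightarrow> 'u set"
    and c nxt :: "week \<Rightarrow> 'j \<Rightarrow> real \<Rightarrow> 'u \<Rightarrow> real"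
    and V Vlow :: "week \<Rightarrow> 'j \<Rightarrow> real \<Rightarrow> real"
    and t :: week and j :: 'j
    and v \<beta> :: "'j \<Rightarrow> real"
  assumes "0 \<le> \<gamma>"
    and "storage_problem Smax \<delta> \<gamma> P U c nxt V"
    and "s_hat \<in> {0..Smax}"
    and "\<And>j' s. s \<in> {0..Smax} \<Longrightarrow> Vlow (t + 1) j' s \<le> V (t + 1) j' s"
    and "\<And>j'. v j' = Vlow (t + 1) j' s_hat"
    and "\<And>j' s. s \<in> {0..Smax} \<Longrightarrow> v j' + \<beta> j' * (s - s_hat) \<le> V (t + 1) j' s"
  shows "(let w = tilted_weight \<gamma> (P t j) v;
              b = (\<Sum>j'\<in>UNIV. w j' * \<beta> j');
              a = risk \<gamma> (P t j) v - b * s_hat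
          in (\<forall>s\<in>{0..Smax}. a + b * s \<le> future_cost \<gamma> P V t j s) \<and>
             ((\<forall>j'. v j' = V (t + 1) j' s_hat) \<longrightarrow>
                a + b * s_hat = future_cost \<gamma> P V t j s_hat)) \<and>
         (\<forall>j'. ((\<lambda>g. tilted_weight g (P t j) v j') \<longlongrightarrow> P t j j') (at_right 0)) \<and>
         ((\<lambda>g. risk g (P t j) v) \<longlongrightarrow> (\<Sum>j'\<in>UNIV. P t j j' * v j')) (at_right 0)"
proof -
  interpret storage_problem Smax \<delta> \<gamma> P U c nxt V
    by (rule assms(2))
  define p where "p = P t j"
  have p: "\<And>k. 0 \<le> p k" "sum p UNIV = 1"
    by (simp_all add: p_def P_nonneg P_row_sum)
  define b where "b = (\<Sum>k\<in>UNIV. tilted_weight \<gamma> p v k * \<beta> k)"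
  have "risk \<gamma> p v - b * s_hat + b * s \<le> future_cost \<gamma> P V t j s" if "s \<in> {0..Smax}" for s
  proof -
    \<comment> \<open>The cut is the tangent at \<open>v\<close> for the increment
      \<open>\<beta> k * (s - s_hat)\<close>, the change of each affine minorant between
      \<open>s_hat\<close> and \<open>s\<close>.\<close>
    have "risk \<gamma> p v - b * s_hat + b * s
        = risk \<gamma> p v + (\<Sum>k\<in>UNIV. tilted_weight \<gamma> p v k * (\<beta> k * (s - s_hat)))"
      by (simp add: b_def algebra_simps sum_subtractf sum_distrib_left)
    also have "\<dots> \<le> risk \<gamma> p (\<lambda>k. v k + \<beta> k * (s - s_hat))"
      by (rule risk_ge_tangent[OF assms(1) p])
    also have "\<dots> \<le> risk \<gamma> p (\<lambda>k. V (t + 1) k s)"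
      by (rule risk_mono[OF assms(1) p assms(6)[OF that]])
    finally show ?thesis
      by (simp add: future_cost_def p_def)
  qed
  moreover have "risk \<gamma> p v - b * s_hat + b * s_hat = future_cost \<gamma> P V t j s_hat"
    if "\<forall>k. v k = V (t + 1) k s_hat"
  proof -
    \<comment> \<open>At \<open>s_hat\<close> the terms in \<open>b\<close> cancel, leaving
      \<open>risk \<gamma> p v\<close>; tightness makes \<open>v\<close> the very vector whose risk
      is the future cost.\<close>
    have "v = (\<lambda>k. V (t + 1) k s_hat)"
      using that by (intro ext) simp
    then show ?thesis
      by (simp add: future_cost_def p_def)
  qed
  ultimately show ?thesis
    using tilted_weight_tendsto[OF p(2)] risk_tendsto[OF p(2)]
    by (simp only: Let_def b_def p_def) blast
qed

end
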